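(* Let $\Delta\ge 3$ be an integer and let $G$ be a planar graph with maximum degree $\Delta(G)\ge \Delta$. If $g(G)\ge 4+\left\lceil\frac{8}{\Delta-2}\right\rceil$, then $\chi'_g(G)=\chi'_{gl}(G)=\Delta(G)$.
   Context: All graphs are finite, simple and undirected; $\Delta(G)$ is the maximum degree of $G$, and the girth $g(G)$ is the length of a smallest cycle of $G$, or $+\infty$ if $G$ is a forest. Let $H$ be a graph, $A$ an Abelian group, and fix an arbitrary orientation $D$ of $E(H)$. For a function $f:E(H)\to A$, an $(A,f)$-coloring of $H$ is a map $c:V(H)\to A$ such that $c(u)-c(v)\ne f(uv)$ for every edge $uv$ directed from $u$ to $v$. $H$ is $A$-colorable if it has an $(A,f)$-coloring for every $f:E(H)\to A$ (this does not depend on $D$). The group chromatic number $\chi_g(H)$ is the minimum $m$ such that $H$ is $A$-colorable for every Abelian group $A$ of order at least $m$. $H$ is group $k$-choosable if for every Abelian group $A$ of order at least $k$, every list assignment $L:V(H)\to 2^A$ with $|L(v)|=k$ for all $v$, and every $f:E(H)\to A$, there is an $(A,f)$-coloring $c$ of $H$ with $c(v)\in L(v)$ for all $v\in V(H)$ (again independent of $D$). The group choice number $\chi_{gl}(H)$ is the minimum $k$ such that $H$ is group $k$-choosable. For a graph $G$ with line graph $\mathcal{L}(G)$ (vertices are the edges of $G$, two adjacent iff the edges share an endpoint), define the group edge chromatic number $\chi'_g(G)=\chi_g(\mathcal{L}(G))$ and the group edge choice number $\chi'_{gl}(G)=\chi_{gl}(\mathcal{L}(G))$. *)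

theory Defs
  imports
    "HOL-Analysis.Analysis"
    "HOL-Algebra.Group"
    "HOL-Library.Extended_Nat"
    "HOL-Library.Infinite_Typeclass"
begin

section \<open>Finite simple graphs\<close>

record 'a ugraph =
  verts :: "'a set"
  edges :: "'a set set"

definition simple_graph :: "'a ugraph \<Rightarrow> bool" where
  "simple_graph G \<longleftrightarrow> finite (verts G) \<and> (\<forall>e\<in>edges G. e \<subseteq> verts G \<and> card e = 2)"

definition vertex_degree :: "'a ugraph \<Rightarrow> 'a \<Rightarrow> nat" where
  "vertex_degree G v = card {e \<in> edges G. v \<in> e}"

text \<open>The element 0 only serves to give the graph without vertices maximum degree 0.\<close>

definition max_degree :: "'a ugraph \<Rightarrow> nat" where
  "max_degree G = Max (insert 0 (vertex_degree G ` verts G))"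

definition graph_cycle :: "'a ugraph \<Rightarrow> 'a list \<Rightarrow> bool" where
  "graph_cycle G vs \<longleftrightarrow> 3 \<le> length vs \<and> distinct vs \<and>
     (\<forall>i<length vs. {vs ! i, vs ! (Suc i mod length vs)} \<in> edges G)"

text \<open>For a forest this is the infimum of the empty set in \<^typ>\<open>enat\<close>, that is, \<open>\<infinity>\<close>.\<close>

definition girth :: "'a ugraph \<Rightarrow> enat" where
  "girth G = (INF vs\<in>{vs. graph_cycle G vs}. enat (length vs))"

definition line_graph :: "'a ugraph \<Rightarrow> 'a set ugraph" where
  "line_graph G = \<lparr> verts = edges G,
     edges = {{e, e'} | e e'. e \<in> edges G \<and> e' \<in> edges G \<and> e \<noteq> e' \<and> e \<inter> e' \<noteq> {}} \<rparr>"

text \<open>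
  A drawing in the plane places the vertices at distinct points and draws every edge as a
  (continuous) simple arc between its two ends, such that arcs meet the vertices only at
  their own ends, and two different arcs meet only at common ends.
\<close>

definition plane_drawing :: "'a ugraph \<Rightarrow> ('a \<Rightarrow> complex) \<Rightarrow> ('a set \<Rightarrow> real \<Rightarrow> complex) \<Rightarrow> bool" where
  "plane_drawing G p \<gamma> \<longleftrightarrow>
     inj_on p (verts G) \<and>
     (\<forall>e\<in>edges G. arc (\<gamma> e) \<and> {pathstart (\<gamma> e), pathfinish (\<gamma> e)} = p ` e \<and>
        path_image (\<gamma> e) \<inter> p ` verts G = p ` e) \<and>
     (\<forall>e\<in>edges G. \<forall>e'\<in>edges G. e \<noteq> e' \<longrightarrow>
        path_image (\<gamma> e) \<inter> path_image (\<gamma> e') = p ` (e \<inter> e'))"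

definition planar :: "'a ugraph \<Rightarrow> bool" where
  "planar G \<longleftrightarrow> (\<exists>p \<gamma>. plane_drawing G p \<gamma>)"

section \<open>Group colorings\<close>

definition orientation :: "'a ugraph \<Rightarrow> ('a \<times> 'a) set \<Rightarrow> bool" where
  "orientation H D \<longleftrightarrow>
     (\<forall>(u, v)\<in>D. {u, v} \<in> edges H) \<and>
     (\<forall>u v. {u, v} \<in> edges H \<longrightarrow> ((u, v) \<in> D) \<noteq> ((v, u) \<in> D))"

text \<open>
  Abelian groups are those of \<^locale>\<open>comm_group\<close>, written multiplicatively: the
  condition \<open>c(u) - c(v) \<noteq> f(uv)\<close> becomes \<open>c u \<otimes> inv (c v) \<noteq> f {u, v}\<close>.
\<close>

definition group_coloring ::
    "'g monoid \<Rightarrow> 'a ugraph \<Rightarrow> ('a \<times> 'a) set \<Rightarrow> ('a set \<Rightarrow> 'g) \<Rightarrow> ('a \<Rightarrow> 'g) \<Rightarrow> bool" where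
  "group_coloring A H D f c \<longleftrightarrow> c \<in> verts H \<rightarrow> carrier A \<and>
     (\<forall>(u, v)\<in>D. c u \<otimes>\<^bsub>A\<^esub> inv\<^bsub>A\<^esub> (c v) \<noteq> f {u, v})"

definition group_colorable_wrt :: "'g monoid \<Rightarrow> 'a ugraph \<Rightarrow> ('a \<times> 'a) set \<Rightarrow> bool" where
  "group_colorable_wrt A H D \<longleftrightarrow>
     (\<forall>f \<in> edges H \<rightarrow> carrier A. \<exists>c. group_coloring A H D f c)"

definition list_assignment ::
    "'g monoid \<Rightarrow> 'a ugraph \<Rightarrow> nat \<Rightarrow> ('a \<Rightarrow> 'g set) \<Rightarrow> bool" where
  "list_assignment A H k L \<longleftrightarrow>
     (\<forall>v\<in>verts H. L v \<subseteq> carrier A \<and> finite (L v) \<and> card (L v) = k)"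

definition group_list_colorable_wrt ::
    "'g monoid \<Rightarrow> 'a ugraph \<Rightarrow> ('a \<times> 'a) set \<Rightarrow> ('a \<Rightarrow> 'g set) \<Rightarrow> bool" where
  "group_list_colorable_wrt A H D L \<longleftrightarrow>
     (\<forall>f \<in> edges H \<rightarrow> carrier A. \<exists>c. group_coloring A H D f c \<and> (\<forall>v\<in>verts H. c v \<in> L v))"

text \<open>
  The orientation is arbitrary; the following definitions quantify over all orientations.
  Any single one gives the same notions, see \<open>group_colorable_orientation\<close> and
  \<open>group_list_colorable_orientation\<close> below.
\<close>

definition group_colorable :: "'g monoid \<Rightarrow> 'a ugraph \<Rightarrow> bool" where
  "group_colorable A H \<longleftrightarrow> (\<forall>D. orientation H D \<longrightarrow> group_colorable_wrt A H D)"

definition group_list_colorable :: "'g monoid \<Rightarrow> 'a ugraph \<Rightarrow> ('a \<Rightarrow> 'g set) \<Rightarrow> bool" where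
  "group_list_colorable A H L \<longleftrightarrow> (\<forall>D. orientation H D \<longrightarrow> group_list_colorable_wrt A H D L)"

definition order_at_least :: "'g monoid \<Rightarrow> nat \<Rightarrow> bool" where
  "order_at_least A m \<longleftrightarrow> infinite (carrier A) \<or> m \<le> card (carrier A)"

text \<open>
  HOL cannot quantify over the types of group elements inside a formula, so the type
  \<open>'g\<close> of the elements is a parameter. It is required to be infinite, so that the groups
  with carrier in \<open>'g\<close> comprise, up to isomorphism, all finite Abelian groups, and, as
  \<open>'g\<close> is arbitrary, infinite groups of every cardinality are reached as well.
\<close>

definition group_choosable :: "'g::infinite itself \<Rightarrow> nat \<Rightarrow> 'a ugraph \<Rightarrow> bool" where
  "group_choosable T k H \<longleftrightarrow>
     (\<forall>A :: 'g monoid. comm_group A \<and> order_at_least A k \<longrightarrow>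
        (\<forall>L. list_assignment A H k L \<longrightarrow> group_list_colorable A H L))"

text \<open>
  As orders of groups are positive, \<open>m\<close> ranges over the positive integers (so that an
  edgeless graph has group chromatic number 1).
\<close>

definition group_chromatic_number :: "'g::infinite itself \<Rightarrow> 'a ugraph \<Rightarrow> nat" where
  "group_chromatic_number T H =
     (LEAST m. 0 < m \<and>
        (\<forall>A :: 'g monoid. comm_group A \<and> order_at_least A m \<longrightarrow> group_colorable A H))"

definition group_choice_number :: "'g::infinite itself \<Rightarrow> 'a ugraph \<Rightarrow> nat" where
  "group_choice_number T H = (LEAST k. group_choosable T k H)"

definition group_edge_chromatic_number :: "'g::infinite itself \<Rightarrow> 'a ugraph \<Rightarrow> nat" where
  "group_edge_chromatic_number T G = group_chromatic_number T (line_graph G)"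

definition group_edge_choice_number :: "'g::infinite itself \<Rightarrow> 'a ugraph \<Rightarrow> nat" where
  "group_edge_choice_number T G = group_choice_number T (line_graph G)"

section \<open>Independence of the orientation\<close>

lemma orientation_exists:
  assumes "simple_graph H"
  shows "\<exists>D. orientation H D"
proof
  let ?h = "\<lambda>e. SOME x. x \<in> e"
  let ?D = "{(u, v). {u, v} \<in> edges H \<and> u = ?h {u, v}}"
  have h: "?h {u, v} = u \<or> ?h {u, v} = v" for u v :: 'a
    using someI[of "\<lambda>x. x \<in> {u, v}" u] by blast
  have ne: "u \<noteq> v" if "{u, v} \<in> edges H" for u v
  proof
    assume "u = v"
    then have "card {u, v} = 1" by simp
    moreover have "card {u, v} = 2"
      using assms that unfolding simple_graph_def by blast
    ultimately show False by simp
  qed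
  have "((u, v) \<in> ?D) \<noteq> ((v, u) \<in> ?D)" if e: "{u, v} \<in> edges H" for u v
  proof -
    have "{v, u} = {u, v}" by (rule insert_commute)
    then show ?thesis
      using h[of u v] ne[OF e] e unfolding mem_Collect_eq prod.case by metis
  qed
  then show "orientation H ?D"
    unfolding orientation_def by blast
qed

lemma group_coloring_reorient:
  assumes A: "comm_group A" and H: "simple_graph H"
    and D: "orientation H D" "orientation H D'" and f: "f \<in> edges H \<rightarrow> carrier A"
  obtains f' where "f' \<in> edges H \<rightarrow> carrier A"
    and "\<And>c. group_coloring A H D f' c \<Longrightarrow> group_coloring A H D' f c"
proof -
  interpret comm_group A by (fact A)
  define f' where "f' e = (if \<exists>u v. e = {u, v} \<and> (u, v) \<in> D \<and> (u, v) \<in> D' then f e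
    else inv\<^bsub>A\<^esub> (f e))" for e
  show thesis
  proof
    show "f' \<in> edges H \<rightarrow> carrier A"
      using f by (auto simp: f'_def Pi_def)
    fix c assume c: "group_coloring A H D f' c"
    have "c u \<otimes>\<^bsub>A\<^esub> inv\<^bsub>A\<^esub> (c v) \<noteq> f {u, v}" if uv: "(u, v) \<in> D'" for u v
    proof -
      have e: "{u, v} \<in> edges H"
        using D(2) uv by (auto simp: orientation_def)
      then have cuv: "c u \<in> carrier A" "c v \<in> carrier A"
        using H c by (auto simp: simple_graph_def group_coloring_def Pi_def)
      have fe: "f {u, v} \<in> carrier A"
        using f e by auto
      have vu: "(v, u) \<notin> D'"
        using D(2) e uv by (auto simp: orientation_def)
      show ?thesis
      proof (cases "(u, v) \<in> D")
        case True
        then have "f' {u, v} = f {u, v}"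
          using uv by (auto simp: f'_def)
        then show ?thesis
          using c True by (force simp: group_coloring_def)
      next
        case False
        then have "(v, u) \<in> D"
          using D(1) e by (auto simp: orientation_def)
        moreover have "f' {v, u} = inv\<^bsub>A\<^esub> (f {u, v})"
          using False vu by (auto simp: f'_def doubleton_eq_iff insert_commute)
        ultimately have "c v \<otimes>\<^bsub>A\<^esub> inv\<^bsub>A\<^esub> (c u) \<noteq> inv\<^bsub>A\<^esub> (f {u, v})"
          using c by (force simp: group_coloring_def)
        moreover have "c v \<otimes>\<^bsub>A\<^esub> inv\<^bsub>A\<^esub> (c u) = inv\<^bsub>A\<^esub> (c u \<otimes>\<^bsub>A\<^esub> inv\<^bsub>A\<^esub> (c v))"
          using cuv by (simp add: inv_mult_group)
        ultimately show ?thesis by auto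
      qed
    qed
    then show "group_coloring A H D' f c"
      using c by (auto simp: group_coloring_def)
  qed
qed

lemma group_colorable_orientation:
  assumes A: "comm_group A" and H: "simple_graph H" and D: "orientation H D"
  shows "group_colorable A H \<longleftrightarrow> group_colorable_wrt A H D"
proof
  assume "group_colorable A H"
  then show "group_colorable_wrt A H D"
    using D by (simp add: group_colorable_def)
next
  assume *: "group_colorable_wrt A H D"
  have "\<exists>c. group_coloring A H D' f c"
    if D': "orientation H D'" and f: "f \<in> edges H \<rightarrow> carrier A" for D' f
  proof -
    obtain f' where f': "f' \<in> edges H \<rightarrow> carrier A"
      "\<And>c. group_coloring A H D f' c \<Longrightarrow> group_coloring A H D' f c"
      using group_coloring_reorient[OF A H D D' f] by blast
    from * f'(1) obtain c where "group_coloring A H D f' c"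
      unfolding group_colorable_wrt_def by blast
    then show ?thesis using f'(2) by blast
  qed
  then show "group_colorable A H"
    unfolding group_colorable_def group_colorable_wrt_def by blast
qed

lemma group_list_colorable_orientation:
  assumes A: "comm_group A" and H: "simple_graph H" and D: "orientation H D"
  shows "group_list_colorable A H L \<longleftrightarrow> group_list_colorable_wrt A H D L"
proof
  assume "group_list_colorable A H L"
  then show "group_list_colorable_wrt A H D L"
    using D by (simp add: group_list_colorable_def)
next
  assume *: "group_list_colorable_wrt A H D L"
  have "\<exists>c. group_coloring A H D' f c \<and> (\<forall>v\<in>verts H. c v \<in> L v)"
    if D': "orientation H D'" and f: "f \<in> edges H \<rightarrow> carrier A" for D' f
  proof -
    obtain f' where f': "f' \<in> edges H \<rightarrow> carrier A"
      "\<And>c. group_coloring A H D f' c \<Longrightarrow> group_coloring A H D' f c"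
      using group_coloring_reorient[OF A H D D' f] by blast
    from * f'(1) obtain c where "group_coloring A H D f' c" "\<forall>v\<in>verts H. c v \<in> L v"
      unfolding group_list_colorable_wrt_def by blast
    then show ?thesis using f'(2) by blast
  qed
  then show "group_list_colorable A H L"
    unfolding group_list_colorable_def group_list_colorable_wrt_def by blast
qed

end

theory Submission imports Defs begin

text \<open>
  The theorem rests on one reducible configuration: an edge \<open>uv\<close> of a graph with maximum degree \<open>D\<close>
  is light if \<open>d(u) + d(v) \<le> D + 1\<close>. In the line graph such an edge has at most \<open>D - 1\<close> neighbours,
  and in a group coloring every colored neighbour forbids only one color. So if every nonempty
  set \<open>S\<close> of edges contains an edge that is light within \<open>S\<close>, then the edges can be colored greedily
  from lists of size \<open>D\<close>, light edges last (\<open>greedy_coloring\<close>). Conversely, the \<open>D\<close> edges at a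
  vertex of maximum degree need different colors when \<open>f = 0\<close>, so that a group of order less than
  \<open>D\<close> does not suffice (\<open>not_group_colorable_below_degree\<close>).

  Light edges come from counting. If \<open>S\<close> has \<open>m\<close> edges and \<open>n\<close> vertices and none of its edges is
  light, then \<open>n \<le> m (1 / 2 + 1 / D)\<close> (see \<open>light_edge\<close>). On the other hand, a planar graph whose
  cycles have length at least \<open>g\<close> satisfies \<open>m (1 - 2 / g) < n\<close> (see \<open>edge_bound\<close>). Both
  are incompatible when \<open>g (D - 2) \<ge> 4 D\<close>, that is, when \<open>g \<ge> 4 + 8 / (D - 2)\<close>.

  The bound for planar graphs follows in the usual way from two statements about the faces of a
  drawing, that is, the components of its complement. First, there are at least \<open>m - n + 1\<close> faces
  (\<open>Euler_inequality\<close>). Second, if there is more than one face, then every face is incident with at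
  least \<open>g\<close> edges (\<open>face_frontier_has_cycle\<close>) and every edge with at most two faces
  (\<open>incident_faces_le_2\<close>). Since edges are drawn as arbitrary continuous arcs, these statements are
  derived from two theorems of plane topology. The Jordan curve theorem applies to the simple closed
  curve that is drawn by a cycle. Janiszewski's theorem says that if neither of two compact sets
  with connected intersection separates two given points, then neither does their union; it is used
  to show that certain unions of drawn edges do not separate the plane.
\<close>

section \<open>Paths, cycles and forests as edge sets\<close>

fun path_edges :: "'a list \<Rightarrow> 'a set set" where
  "path_edges (x # y # zs) = insert {x, y} (path_edges (y # zs))"
| "path_edges _ = {}"

definition simple_walk :: "'a set set \<Rightarrow> 'a list \<Rightarrow> bool" where
  "simple_walk F xs \<longleftrightarrow> xs \<noteq> [] \<and> distinct xs \<and> path_edges xs \<subseteq> F"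

definition cycle_in :: "'a set set \<Rightarrow> 'a list \<Rightarrow> bool" where
  "cycle_in F xs \<longleftrightarrow> 3 \<le> length xs \<and> simple_walk F xs \<and> {last xs, hd xs} \<in> F"

definition acyclic_edges :: "'a set set \<Rightarrow> bool" where
  "acyclic_edges F \<longleftrightarrow> (\<nexists>xs. cycle_in F xs)"

lemma path_edges_subset: "f \<in> path_edges xs \<Longrightarrow> f \<subseteq> set xs"
  by (induction xs rule: path_edges.induct) auto

lemma finite_path_edges: "finite (path_edges xs)"
  by (induction xs rule: path_edges.induct) auto

lemma path_edges_append:
  "xs \<noteq> [] \<Longrightarrow> path_edges (xs @ y # ys) = path_edges xs \<union> insert {last xs, y} (path_edges (y # ys))"
  by (induction xs rule: path_edges.induct) auto

lemma path_edges_nth: "Suc i < length xs \<Longrightarrow> {xs ! i, xs ! Suc i} \<in> path_edges xs"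
proof (induction xs arbitrary: i rule: path_edges.induct)
  case (1 x y zs)
  then show ?case by (cases i) auto
qed auto

lemma card_path_edges: "distinct xs \<Longrightarrow> card (path_edges xs) = length xs - 1"
proof (induction xs rule: path_edges.induct)
  case (1 x y zs)
  have "{x, y} \<notin> path_edges (y # zs)"
    using path_edges_subset[of "{x, y}" "y # zs"] 1 by auto
  then show ?case using 1 finite_path_edges[of "y # zs"] by simp
qed auto

lemma closing_edge_notin_path_edges:
  assumes "distinct xs" "3 \<le> length xs"
  shows "{last xs, hd xs} \<notin> path_edges xs"
proof -
  obtain x y ys where xs: "xs = x # y # ys" "ys \<noteq> []"
    using assms(2) by (cases xs rule: path_edges.cases) (auto simp: Suc_le_eq)
  then have "last xs \<in> set ys" by simp
  then show ?thesis
    using xs assms(1) path_edges_subset[of "{last xs, x}" "y # ys"]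
    by (auto simp: doubleton_eq_iff)
qed

lemma cycle_in_length_le_card:
  assumes "cycle_in F xs" "finite F"
  shows "length xs \<le> card F"
proof -
  let ?e = "{last xs, hd xs}"
  have xs: "distinct xs" "3 \<le> length xs" "path_edges xs \<subseteq> F" "?e \<in> F"
    using assms(1) by (auto simp: cycle_in_def simple_walk_def)
  have "length xs = card (insert ?e (path_edges xs))"
    using xs closing_edge_notin_path_edges[of xs] card_path_edges[of xs] finite_path_edges[of xs]
    by simp
  also have "\<dots> \<le> card F"
    using xs assms(2) by (intro card_mono) auto
  finally show ?thesis .
qed

text \<open>
  If the new edge leads back to a vertex of the path, then an initial segment of the path already
  reaches that vertex. So reachability by paths without repeated vertices is closed under edges.
\<close>

lemma simple_walk_extend:
  assumes w: "simple_walk F xs" and e: "{last xs, y} \<in> F"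
  obtains zs where "simple_walk F zs" "hd zs = hd xs" "last zs = y"
proof (cases "y \<in> set xs")
  case True
  then obtain as bs where xs: "xs = as @ y # bs" by (meson split_list)
  show thesis
  proof (rule that[of "as @ [y]"])
    show "simple_walk F (as @ [y])"
      using w unfolding xs simple_walk_def
      by (cases "as = []") (auto simp: path_edges_append)
  qed (use xs in \<open>cases as; auto\<close>)+
next
  case False
  show thesis
    by (rule that[of "xs @ [y]"])
      (use w e False in \<open>auto simp: simple_walk_def path_edges_append\<close>)
qed

lemma card_2_other_end:
  assumes "card e = 2" "v \<in> e"
  obtains w where "e = {v, w}" "w \<noteq> v"
  using assms by (metis card_2_iff doubleton_eq_iff insertE singletonD)

text \<open>
  The first vertex of a longest path is a leaf: a second edge at this vertex would either prolong the
  path or close a cycle with an initial segment of it.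
\<close>

lemma acyclic_edges_leaf:
  assumes fin: "finite F" and c2: "\<And>e. e \<in> F \<Longrightarrow> card e = 2"
    and acyc: "acyclic_edges F" and ne: "F \<noteq> {}"
  obtains e v where "e \<in> F" "v \<in> e" "v \<notin> \<Union>(F - {e})"
proof -
  let ?P = "\<lambda>xs. simple_walk F xs \<and> 2 \<le> length xs"
  obtain u v where uv: "{u, v} \<in> F" "u \<noteq> v"
    using ne c2 by (metis card_2_iff ex_in_conv)
  then have ex: "?P [u, v]" by (simp add: simple_walk_def)
  have bound: "\<forall>xs. ?P xs \<longrightarrow> length xs < card F + 2"
  proof (intro allI impI)
    fix xs assume "?P xs"
    then show "length xs < card F + 2"
      using card_path_edges[of xs] card_mono[OF fin, of "path_edges xs"]
      by (auto simp: simple_walk_def)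
  qed
  obtain xs where xs: "?P xs" and max: "\<And>ys. ?P ys \<Longrightarrow> length ys \<le> length xs"
    using ex_has_greatest_nat[of ?P "[u, v]" length "card F + 2"] ex bound by auto
  obtain y z zs where yz: "xs = y # z # zs"
    using xs by (cases xs rule: path_edges.cases) auto
  have yzF: "{y, z} \<in> F" using xs yz by (auto simp: simple_walk_def)
  have "f = {y, z}" if f: "f \<in> F" "y \<in> f" for f
  proof (rule ccontr)
    assume neq: "f \<noteq> {y, z}"
    obtain w where w: "f = {y, w}" "w \<noteq> y"
      using card_2_other_end[OF c2[OF f(1)] f(2)] .
    have wz: "w \<noteq> z" using neq w by auto
    show False
    proof (cases "w \<in> set zs")
      case False
      then have "?P (w # xs)"
        using xs yz w wz f by (auto simp: simple_walk_def insert_commute)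
      then show False using max[of "w # xs"] by simp
    next
      case True
      then obtain as bs where zs: "zs = as @ w # bs" by (meson split_list)
      have "path_edges xs = path_edges ((y # z # as) @ w # bs)" using yz zs by simp
      also have "\<dots> \<supseteq> path_edges (y # z # as @ [w])"
        using path_edges_append[of "y # z # as" w bs] path_edges_append[of "y # z # as" w "[]"]
        by auto
      finally have "path_edges (y # z # as @ [w]) \<subseteq> F"
        using xs by (auto simp: simple_walk_def)
      then have "cycle_in F (y # z # as @ [w])"
        using xs yz zs f w by (auto simp: cycle_in_def simple_walk_def insert_commute)
      then show False using acyc by (auto simp: acyclic_edges_def)
    qed
  qed
  then show thesis using that[OF yzF, of y] by auto
qed

lemma acyclic_edges_subset: "acyclic_edges F \<Longrightarrow> F' \<subseteq> F \<Longrightarrow> acyclic_edges F'"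
  unfolding acyclic_edges_def cycle_in_def simple_walk_def by blast

text \<open>
  A forest is built by attaching its edges one at a time, each with an end \<open>v\<close> that is new.
\<close>

lemma acyclic_edges_induct [consumes 3, case_names empty insert]:
  assumes "finite F" and "\<forall>e\<in>F. card e = 2" and "acyclic_edges F"
    and "P {}"
    and "\<And>F' e v. insert e F' \<subseteq> F \<Longrightarrow> e \<notin> F' \<Longrightarrow> v \<in> e \<Longrightarrow> v \<notin> \<Union>F' \<Longrightarrow> P F' \<Longrightarrow> P (insert e F')"
  shows "P F"
  using assms
proof (induction "card F" arbitrary: F)
  case 0
  then show ?case by simp
next
  case (Suc n)
  then have "F \<noteq> {}" by auto
  with Suc.prems obtain e v where e: "e \<in> F" "v \<in> e" "v \<notin> \<Union>(F - {e})"
    using acyclic_edges_leaf[of F] by blast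
  have "P (F - {e})"
    by (rule Suc.hyps(1))
      (use Suc.prems Suc.hyps(2) e acyclic_edges_subset[of F "F - {e}"] in
        \<open>auto intro!: Suc.prems(5)\<close>)
  then have "P (insert e (F - {e}))"
    using e Suc.prems(5)[of e "F - {e}" v] by blast
  then show ?case using e by (simp add: insert_absorb)
qed

lemma acyclic_edges_card_le:
  assumes "finite F" "\<forall>e\<in>F. card e = 2" "acyclic_edges F"
  shows "card F \<le> card (\<Union>F)"
  using assms
proof (induction rule: acyclic_edges_induct)
  case (insert F' e v)
  have fin: "finite F'" "finite (\<Union>F')" "finite e"
    using assms(1,2) insert(1)
    by (auto intro!: finite_Union intro: finite_subset simp: card_2_iff subset_eq)
  have "card (insert v (\<Union>F')) \<le> card (\<Union>(insert e F'))"
    using fin insert by (intro card_mono) auto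
  then show ?case using insert fin by auto
qed simp

lemma girth_le_cycle_in:
  assumes "cycle_in (edges G) xs"
  shows "girth G \<le> enat (length xs)"
proof -
  have l: "3 \<le> length xs" and d: "distinct xs" and
    s: "path_edges xs \<subseteq> edges G" "{last xs, hd xs} \<in> edges G"
    using assms by (auto simp: cycle_in_def simple_walk_def)
  have "{xs ! i, xs ! (Suc i mod length xs)} \<in> edges G" if i: "i < length xs" for i
  proof (cases "Suc i = length xs")
    case True
    moreover have "xs \<noteq> []" using l by auto
    ultimately have "last xs = xs ! i" "hd xs = xs ! 0"
      by (simp_all add: last_conv_nth hd_conv_nth flip: True)
    then show ?thesis using s(2) True by simp
  next
    case False
    then show ?thesis using i s(1) path_edges_nth[of i xs] by auto
  qed
  then have "graph_cycle G xs" using l d by (auto simp: graph_cycle_def)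
  then show ?thesis unfolding girth_def by (intro INF_lower) auto
qed

section \<open>Faces of a drawing\<close>

lemma connected_meets_frontier:
  assumes "connected S" "A \<subseteq> S" "B \<subseteq> S" "A \<noteq> {}" "B \<noteq> {}" "A \<inter> B = {}"
  shows "S \<inter> frontier A \<noteq> {}"
  using assms by (intro connected_Int_frontier) auto

locale drawing =
  fixes E :: "'a set set" and p :: "'a \<Rightarrow> complex" and \<gamma> :: "'a set \<Rightarrow> real \<Rightarrow> complex"
  assumes finite_E: "finite E"
    and card_edge: "e \<in> E \<Longrightarrow> card e = 2"
    and arc_edge: "e \<in> E \<Longrightarrow> arc (\<gamma> e)"
    and ends_edge: "e \<in> E \<Longrightarrow> {pathstart (\<gamma> e), pathfinish (\<gamma> e)} = p ` e"
    and edges_meet: "e \<in> E \<Longrightarrow> e' \<in> E \<Longrightarrow> e \<noteq> e' \<Longrightarrow>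
      path_image (\<gamma> e) \<inter> path_image (\<gamma> e') = p ` (e \<inter> e')"
begin

definition drawn :: "'a set set \<Rightarrow> complex set" where
  "drawn F = (\<Union>e\<in>F. path_image (\<gamma> e))"

definition faces :: "'a set set \<Rightarrow> complex set set" where
  "faces F = components (- drawn F)"

text \<open>
  A face that touches an edge only in an end of the edge is not incident with it, because
  arbitrarily many faces can meet in a vertex.
\<close>

definition incident :: "complex set \<Rightarrow> 'a set \<Rightarrow> bool" where
  "incident \<phi> e \<longleftrightarrow> frontier \<phi> \<inter> (path_image (\<gamma> e) - p ` e) \<noteq> {}"

lemma finite_sub: "F \<subseteq> E \<Longrightarrow> finite F"
  using finite_E finite_subset by blast

lemma card_subset_edges: "F \<subseteq> E \<Longrightarrow> \<forall>e\<in>F. card e = 2"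
  using card_edge by blast

lemma finite_Union_sub: "F \<subseteq> E \<Longrightarrow> finite (\<Union>F)"
  by (metis card_subset_edges card_ge_0_finite finite_Union finite_sub zero_less_numeral)

lemma compact_drawn: "F \<subseteq> E \<Longrightarrow> compact (drawn F)"
  unfolding drawn_def
  by (intro compact_UN) (auto simp: finite_sub arc_edge compact_arc_image)

lemma closed_drawn: "F \<subseteq> E \<Longrightarrow> closed (drawn F)"
  by (simp add: compact_drawn compact_imp_closed)

lemma drawn_Un: "drawn (F \<union> F') = drawn F \<union> drawn F'"
  by (auto simp: drawn_def)

lemma drawn_insert: "drawn (insert e F) = path_image (\<gamma> e) \<union> drawn F"
  by (auto simp: drawn_def)

lemma drawn_mono: "F \<subseteq> F' \<Longrightarrow> drawn F \<subseteq> drawn F'"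
  by (auto simp: drawn_def)

lemma edge_Int_drawn:
  assumes "e \<in> E" "F \<subseteq> E" "e \<notin> F"
  shows "path_image (\<gamma> e) \<inter> drawn F = p ` (e \<inter> \<Union>F)"
proof -
  have "path_image (\<gamma> e) \<inter> drawn F = (\<Union>f\<in>F. path_image (\<gamma> e) \<inter> path_image (\<gamma> f))"
    by (auto simp: drawn_def)
  also have "\<dots> = (\<Union>f\<in>F. p ` (e \<inter> f))"
    using assms by (intro SUP_cong refl edges_meet) auto
  finally show ?thesis by auto
qed

lemma ends_in_edge: "e \<in> E \<Longrightarrow> p ` e \<subseteq> path_image (\<gamma> e)"
  by (simp add: pathstart_in_path_image pathfinish_in_path_image flip: ends_edge)

lemma
  assumes "e \<in> E"
  shows connected_open_edge: "connected (path_image (\<gamma> e) - p ` e)"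
    and open_edge_ne: "path_image (\<gamma> e) - p ` e \<noteq> {}"
  using connected_simple_path_endless[of "\<gamma> e"] nonempty_simple_path_endless[of "\<gamma> e"]
    arc_imp_simple_path[OF arc_edge[OF assms]]
  by (simp_all flip: ends_edge[OF assms])

lemma faces_eqI:
  assumes "\<phi> \<in> faces F" "\<psi> \<in> faces F" "a \<in> \<phi>" "b \<in> \<psi>" "connected_component (- drawn F) a b"
  shows "\<phi> = \<psi>"
proof -
  obtain T where T: "connected T" "T \<subseteq> - drawn F" "a \<in> T" "b \<in> T"
    using assms(5) by (auto simp: connected_component_def)
  have "T \<subseteq> \<phi>"
    by (rule components_maximal[OF assms(1)[unfolded faces_def] T(1,2)]) (use T assms in auto)
  then have "b \<in> \<phi> \<inter> \<psi>" using T assms by auto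
  then show ?thesis
    using assms(1,2) components_nonoverlap[of \<phi> "- drawn F" \<psi>] by (auto simp: faces_def)
qed

lemma connected_Compl_edge: "e \<in> E \<Longrightarrow> connected (- path_image (\<gamma> e))"
  by (intro connected_arc_complement arc_edge) simp_all

text \<open>
  A single arc does not separate the plane. A forest is obtained by attaching arcs at a single point
  at most, and Janiszewski's theorem applies at every such step.
\<close>

lemma forest_connected_Compl:
  assumes "F \<subseteq> E" "acyclic_edges F"
  shows "connected (- drawn F)"
  using finite_sub[OF assms(1)] card_subset_edges[OF assms(1)] assms(2)
proof (induction rule: acyclic_edges_induct)
  case empty
  then show ?case by (simp add: drawn_def connected_UNIV)
next
  case (insert F' e v)
  then have e: "e \<in> E" "F' \<subseteq> E" using assms(1) by auto
  obtain w where w: "e = {v, w}"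
    using card_2_other_end[OF card_edge[OF e(1)] insert(3)] .
  have "path_image (\<gamma> e) \<inter> drawn F' \<subseteq> {p w}"
    using edge_Int_drawn[OF e insert(2)] insert(4) w by auto
  then have "connected (path_image (\<gamma> e) \<inter> drawn F')"
    by (metis connected_empty connected_sing subset_singletonD)
  then show ?case unfolding drawn_insert
    using e insert arc_edge by (intro Janiszewski_connected)
      (auto simp: closed_drawn connected_Compl_edge compact_arc_image)
qed

lemma forest_points_connected_Compl:
  assumes "F \<subseteq> E" "acyclic_edges F" "finite P"
  shows "connected (- (drawn F \<union> P))"
proof -
  have "connected (- drawn F - P)"
    using assms by (intro connected_open_diff_countable forest_connected_Compl)
      (auto simp: closed_drawn open_Compl uncountable_infinite countable_finite)
  then show ?thesis by (simp add: Diff_eq)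
qed

text \<open>
  The frontier of a face consists of points on its incident edges and of finitely many points of
  vertices. It separates the face from any other face, which a forest together with finitely many
  points cannot do.
\<close>

lemma face_frontier_has_cycle:
  assumes F: "F \<subseteq> E" and \<phi>: "\<phi> \<in> faces F" "\<psi> \<in> faces F" "\<phi> \<noteq> \<psi>"
  shows "\<not> acyclic_edges {e \<in> F. incident \<phi> e}"
proof
  let ?B = "{e \<in> F. incident \<phi> e}" and ?P = "p ` \<Union>F"
  assume "acyclic_edges ?B"
  moreover have "finite ?P"
    using finite_Union_sub[OF F] by simp
  ultimately have con: "connected (- (drawn ?B \<union> ?P))"
    using F by (intro forest_points_connected_Compl) auto
  have fr: "frontier \<phi> \<subseteq> drawn ?B \<union> ?P"
  proof
    fix x assume x: "x \<in> frontier \<phi>"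
    then have "x \<in> drawn F"
      using frontier_of_components_closed_complement[OF closed_drawn[OF F]] \<phi>(1)
      by (auto simp: faces_def)
    then show "x \<in> drawn ?B \<union> ?P"
      using x by (auto simp: drawn_def incident_def)
  qed
  have "?P \<subseteq> drawn F"
    unfolding drawn_def image_Union
  proof (rule UN_least)
    fix e assume "e \<in> F"
    then show "p ` e \<subseteq> (\<Union>e\<in>F. path_image (\<gamma> e))" using ends_in_edge[of e] F by blast
  qed
  moreover have "drawn ?B \<subseteq> drawn F" by (rule drawn_mono) blast
  ultimately have sub: "- drawn F \<subseteq> - (drawn ?B \<union> ?P)"
    by (intro Compl_anti_mono Un_least)
  have ne: "\<phi> \<noteq> {}" "\<psi> \<noteq> {}" "\<phi> \<subseteq> - drawn F" "\<psi> \<subseteq> - drawn F"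
    using \<phi> by (simp_all add: faces_def in_components_nonempty in_components_subset)
  have disj: "\<phi> \<inter> \<psi> = {}"
    using \<phi> components_nonoverlap[of \<phi> "- drawn F" \<psi>] by (simp add: faces_def)
  have "\<phi> \<subseteq> - (drawn ?B \<union> ?P)" "\<psi> \<subseteq> - (drawn ?B \<union> ?P)"
    by (rule subset_trans[OF ne(3) sub], rule subset_trans[OF ne(4) sub])
  with con have "- (drawn ?B \<union> ?P) \<inter> frontier \<phi> \<noteq> {}"
    by (rule connected_meets_frontier) (rule ne disj)+
  with fr show False
    by (metis Diff_eq Diff_eq_empty_iff Int_commute double_complement)
qed

lemma oriented_edge:
  assumes e: "e \<in> E" and ab: "p ` e = {a, b}"
  obtains h where "arc h" "pathstart h = a" "pathfinish h = b" "path_image h = path_image (\<gamma> e)"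
proof (cases "pathstart (\<gamma> e) = a")
  case True
  then have "pathfinish (\<gamma> e) = b"
    using ends_edge[OF e] arc_distinct_ends[OF arc_edge[OF e]] ab by (auto simp: doubleton_eq_iff)
  then show thesis using that[of "\<gamma> e"] True arc_edge[OF e] by blast
next
  case False
  then have "pathstart (\<gamma> e) = b" "pathfinish (\<gamma> e) = a"
    using ends_edge[OF e] ab by (auto simp: doubleton_eq_iff)
  then show thesis using that[of "reversepath (\<gamma> e)"] arc_edge[OF e] by (simp add: arc_reversepath)
qed

lemma walk_arc:
  assumes "simple_walk F xs" "F \<subseteq> E" "2 \<le> length xs"
  obtains g where "arc g" "pathstart g = p (hd xs)" "pathfinish g = p (last xs)"
    "path_image g = drawn (path_edges xs)"
  using assms
proof (induction xs arbitrary: thesis rule: path_edges.induct)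
  case (1 x y zs)
  have e: "{x, y} \<in> E" and xy: "x \<noteq> y" using 1(3,4) by (auto simp: simple_walk_def)
  obtain h where h: "arc h" "pathstart h = p x" "pathfinish h = p y"
    "path_image h = path_image (\<gamma> {x, y})"
    using oriented_edge[OF e, of "p x" "p y"] by auto
  show ?case
  proof (cases zs)
    case Nil
    then show ?thesis using h 1(2)[of h] by (simp add: drawn_def)
  next
    case (Cons z zs')
    have w: "simple_walk F (y # zs)" using 1(3) by (auto simp: simple_walk_def)
    obtain g where g: "arc g" "pathstart g = p y" "pathfinish g = p (last (y # zs))"
      "path_image g = drawn (path_edges (y # zs))"
      using 1(1)[OF _ w 1(4)] Cons by auto
    have sub: "path_edges (y # zs) \<subseteq> E" using w 1(4) by (auto simp: simple_walk_def)
    have x: "x \<notin> \<Union>(path_edges (y # zs))"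
      using 1(3) path_edges_subset[of _ "y # zs"] by (fastforce simp: simple_walk_def)
    then have "{x, y} \<notin> path_edges (y # zs)" by auto
    then have "path_image h \<inter> path_image g \<subseteq> {p y}"
      using edge_Int_drawn[OF e sub] x h g by auto
    then have "arc (h +++ g)" using h g by (intro arc_join) auto
    then show ?thesis
      using 1(2)[of "h +++ g"] h g by (simp add: path_image_join drawn_insert)
  qed
qed auto

text \<open>
  An edge that joins the ends of a path closes it to a Jordan curve, the union of the edge and an
  arc \<open>A\<close> that draws the path.
\<close>

lemma closed_walk_Jordan:
  assumes F: "F \<subseteq> E" "e \<in> E" "e \<notin> F"
    and xs: "simple_walk F xs" "e = {last xs, hd xs}"
  obtains A "inner" outer where "connected A" "A \<subseteq> drawn F" "compact (path_image (\<gamma> e) \<union> A)"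
    "p ` e \<subseteq> A"
    "open inner" "open outer" "connected inner" "connected outer" "inner \<inter> outer = {}"
    "inner \<union> outer = - (path_image (\<gamma> e) \<union> A)"
    "path_image (\<gamma> e) \<subseteq> frontier inner" "path_image (\<gamma> e) \<subseteq> frontier outer"
proof -
  have "hd xs \<noteq> last xs" using card_edge[OF F(2)] xs(2) by auto
  then have "2 \<le> length xs"
    by (cases xs rule: path_edges.cases) (use xs in \<open>auto simp: simple_walk_def\<close>)
  then obtain g where g: "arc g" "pathstart g = p (hd xs)" "pathfinish g = p (last xs)"
    "path_image g = drawn (path_edges xs)"
    using walk_arc[OF xs(1) F(1)] by blast
  have gF: "path_image g \<subseteq> drawn F"
    using g xs by (auto simp: simple_walk_def intro: drawn_mono[THEN subsetD])
  have pe: "p ` e = {pathstart g, pathfinish g}" using xs g by auto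
  then obtain h where h: "arc h" "pathstart h = pathfinish g" "pathfinish h = pathstart g"
      "path_image h = path_image (\<gamma> e)"
    using oriented_edge[OF F(2), of "pathfinish g" "pathstart g"] by (auto simp: insert_commute)
  have "path_image h \<inter> path_image g \<subseteq> {pathstart h, pathstart g}"
  proof -
    have "path_image h \<inter> path_image g \<subseteq> path_image (\<gamma> e) \<inter> drawn F" using gF h(4) by blast
    also have "\<dots> \<subseteq> p ` e" using edge_Int_drawn[OF F(2,1,3)] by blast
    finally show ?thesis using pe h(2) by (simp add: insert_commute)
  qed
  then have "simple_path (h +++ g)"
    using simple_path_join_loop[OF h(1) g(1) h(3)] h(2) by simp
  moreover have "pathfinish (h +++ g) = pathstart (h +++ g)"
    using h(2) by simp
  ultimately have loop: "simple_path (h +++ g)" "pathfinish (h +++ g) = pathstart (h +++ g)"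
    by auto
  have im: "path_image (h +++ g) = path_image (\<gamma> e) \<union> path_image g"
    using h by (simp add: path_image_join)
  obtain inn out where J: "open inn" "open out" "connected inn" "connected out" "inn \<inter> out = {}"
    "inn \<union> out = - (path_image (\<gamma> e) \<union> path_image g)"
    "frontier inn = path_image (\<gamma> e) \<union> path_image g"
    "frontier out = path_image (\<gamma> e) \<union> path_image g"
    using Jordan_curve[OF loop] unfolding im by metis
  show thesis
  proof (rule that[OF _ gF _ _ J(1-6)])
    show "compact (path_image (\<gamma> e) \<union> path_image g)"
      using g(1) arc_edge[OF F(2)] by (simp add: compact_Un compact_arc_image)
    show "p ` e \<subseteq> path_image g"
      using pe by (simp add: pathstart_in_path_image pathfinish_in_path_image)
    show "connected (path_image g)" using g(1) by (simp add: connected_arc_image)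
  qed (simp_all add: J)
qed

end

lemma finite_card_le_1I:
  assumes "\<And>x y. x \<in> S \<Longrightarrow> y \<in> S \<Longrightarrow> x = y"
  shows "finite S \<and> card S \<le> 1"
proof (cases "S = {}")
  case False
  then obtain x where "x \<in> S" by blast
  then have "S = {x}" using assms by blast
  then show ?thesis by simp
qed simp

context drawing begin

lemma face_nonempty: "\<phi> \<in> faces F \<Longrightarrow> \<phi> \<noteq> {}"
  unfolding faces_def by (rule in_components_nonempty)

lemma face_subset: "\<phi> \<in> faces F \<Longrightarrow> \<phi> \<subseteq> - drawn F"
  unfolding faces_def by (rule in_components_subset)

lemma open_edge_Int_drawn:
  assumes "e \<in> E" "F \<subseteq> E" "e \<notin> F"
  shows "path_image (\<gamma> e) - p ` e \<subseteq> - drawn F"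
  using edge_Int_drawn[OF assms] by blast

lemma drawn_remove: "e \<in> F \<Longrightarrow> drawn F = path_image (\<gamma> e) \<union> drawn (F - {e})"
  using drawn_insert[of e "F - {e}"] by (simp add: insert_absorb)

text \<open>
  After deletion of an edge, the edge without its ends becomes part of one face, and this face
  absorbs all faces that were incident with the edge: they touch it in a frontier point.
\<close>

lemma incident_face_connected_open_edge:
  assumes F: "F \<subseteq> E" "e \<in> F" and \<phi>: "\<phi> \<in> faces F" "incident \<phi> e" "a \<in> \<phi>"
    and x: "x \<in> path_image (\<gamma> e) - p ` e"
  shows "connected_component (- drawn (F - {e})) a x"
proof -
  let ?o = "path_image (\<gamma> e) - p ` e"
  obtain y where y: "y \<in> frontier \<phi>" "y \<in> ?o" using \<phi>(2) by (auto simp: incident_def)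
  have conn: "connected \<phi>" "\<phi> \<subseteq> - drawn F"
    using \<phi>(1) by (simp_all add: faces_def in_components_connected in_components_subset)
  have "connected (insert y \<phi>)"
    by (rule connected_intermediate_closure[OF conn(1)])
      (use y closure_subset in \<open>auto simp: frontier_def\<close>)
  then have "connected (insert y \<phi> \<union> ?o)"
    using connected_open_edge[of e] F y(2) by (intro connected_Un) auto
  moreover have "insert y \<phi> \<union> ?o \<subseteq> - drawn (F - {e})"
    using open_edge_Int_drawn[of e "F - {e}"] F y conn(2) drawn_remove[OF F(2)] by blast
  ultimately show ?thesis
    using \<phi>(3) x by (auto simp: connected_component_def)
qed

lemma incident_faces_connected:
  assumes F: "F \<subseteq> E" "e \<in> F" and "\<phi> \<in> faces F" "incident \<phi> e" "a \<in> \<phi>"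
    and "\<psi> \<in> faces F" "incident \<psi> e" "b \<in> \<psi>"
  shows "connected_component (- drawn (F - {e})) a b"
proof -
  obtain x where x: "x \<in> path_image (\<gamma> e) - p ` e" using open_edge_ne[of e] F by blast
  show ?thesis
    using incident_face_connected_open_edge[OF F assms(3-5) x]
      incident_face_connected_open_edge[OF F assms(6-8) x]
    by (meson connected_component_sym connected_component_trans)
qed

text \<open>
  For an edge \<open>e\<close> on a cycle, two incident faces on the same side of the Jordan curve drawn by the
  cycle coincide. By Janiszewski's theorem, points that are separated neither by the Jordan curve nor
  by the drawing without \<open>e\<close> are not separated by their union: the two sets intersect in the Jordan
  curve without the interior of \<open>e\<close>, and this is an arc.
\<close>

lemma incident_faces_of_cycle_edge:
  assumes F: "F \<subseteq> E" "e \<in> F"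
    and xs: "simple_walk (F - {e}) xs" "e = {last xs, hd xs}"
  shows "finite {\<phi> \<in> faces F. incident \<phi> e} \<and> card {\<phi> \<in> faces F. incident \<phi> e} \<le> 2"
proof -
  let ?S = "{\<phi> \<in> faces F. incident \<phi> e}" and ?T = "drawn (F - {e})" and ?e = "path_image (\<gamma> e)"
  have eE: "e \<in> E" and FE: "F - {e} \<subseteq> E" using F by auto
  obtain A inn out where J: "connected A" "A \<subseteq> ?T" "compact (?e \<union> A)" "p ` e \<subseteq> A"
    "open inn" "open out" "connected inn" "connected out" "inn \<inter> out = {}"
    "inn \<union> out = - (?e \<union> A)" "?e \<subseteq> frontier inn" "?e \<subseteq> frontier out"
    by (rule closed_walk_Jordan[OF FE eE _ xs]) simp
  have one: "\<phi> = \<psi>"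
    if \<phi>: "\<phi> \<in> ?S" "\<phi> \<inter> X \<noteq> {}" and \<psi>: "\<psi> \<in> ?S" "\<psi> \<inter> X \<noteq> {}"
      and X: "connected X" "X \<subseteq> - (?e \<union> A)" for \<phi> \<psi> X
  proof -
    obtain a b where ab: "a \<in> \<phi>" "a \<in> X" "b \<in> \<psi>" "b \<in> X" using \<phi> \<psi> by blast
    have "?e \<inter> ?T \<subseteq> A"
      using edge_Int_drawn[OF eE FE] J(4) by auto
    then have "(?e \<union> A) \<inter> ?T = A" using J(2) by blast
    then have con: "connected ((?e \<union> A) \<inter> ?T)" using J(1) by simp
    have "connected_component (- (?e \<union> A)) a b"
      using X ab unfolding connected_component_def by blast
    moreover have "connected_component (- ?T) a b"
      using incident_faces_connected[OF F] \<phi>(1) \<psi>(1) ab(1,3) by blast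
    ultimately have "connected_component (- ((?e \<union> A) \<union> ?T)) a b"
      by (rule Janiszewski[OF J(3) closed_drawn[OF FE] con])
    moreover have "(?e \<union> A) \<union> ?T = drawn F" using drawn_remove[OF F(2)] J(2) by blast
    ultimately show ?thesis
      using faces_eqI[of \<phi> F \<psi> a b] \<phi> \<psi> ab by simp
  qed
  have le1: "finite {\<phi> \<in> ?S. \<phi> \<inter> X \<noteq> {}} \<and> card {\<phi> \<in> ?S. \<phi> \<inter> X \<noteq> {}} \<le> 1"
    if X: "connected X" "X \<subseteq> - (?e \<union> A)" for X
    by (rule finite_card_le_1I) (use one[OF _ _ _ _ X] in blast)
  have S: "?S \<subseteq> {\<phi> \<in> ?S. \<phi> \<inter> inn \<noteq> {}} \<union> {\<phi> \<in> ?S. \<phi> \<inter> out \<noteq> {}}"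
  proof
    fix \<phi> assume \<phi>: "\<phi> \<in> ?S"
    then have "\<phi> \<noteq> {}" "\<phi> \<subseteq> - drawn F"
      by (auto simp: faces_def dest: in_components_nonempty in_components_subset)
    moreover have "- drawn F \<subseteq> inn \<union> out" using J(2,10) drawn_remove[OF F(2)] by blast
    ultimately show "\<phi> \<in> {\<phi> \<in> ?S. \<phi> \<inter> inn \<noteq> {}} \<union> {\<phi> \<in> ?S. \<phi> \<inter> out \<noteq> {}}"
      using \<phi> by blast
  qed
  have I: "finite {\<phi> \<in> ?S. \<phi> \<inter> inn \<noteq> {}}" "card {\<phi> \<in> ?S. \<phi> \<inter> inn \<noteq> {}} \<le> 1"
    and O: "finite {\<phi> \<in> ?S. \<phi> \<inter> out \<noteq> {}}" "card {\<phi> \<in> ?S. \<phi> \<inter> out \<noteq> {}} \<le> 1"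
    using le1[OF J(7)] le1[OF J(8)] J(10) by blast+
  have "card ?S \<le> card ({\<phi> \<in> ?S. \<phi> \<inter> inn \<noteq> {}} \<union> {\<phi> \<in> ?S. \<phi> \<inter> out \<noteq> {}})"
    using S I O by (intro card_mono) auto
  also have "\<dots> \<le> 2"
    by (rule order_trans[OF card_Un_le]) (use I O in linarith)
  finally show ?thesis using finite_subset[OF S] I O by blast
qed

text \<open>
  Deletion of a bridge \<open>e = {u, v}\<close> leaves the edges \<open>F1\<close> reachable from \<open>u\<close> and the others,
  \<open>F2\<close>. The drawings of \<open>F1\<close> and \<open>F2\<close> are disjoint, and each meets the drawing of \<open>e\<close> in one
  end at most. So Janiszewski's theorem may be applied twice, first to add \<open>F1\<close> to \<open>e\<close> and then to
  add \<open>F2\<close>, and incident faces cannot be separated at all.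
\<close>

lemma incident_faces_of_bridge:
  assumes F: "F \<subseteq> E" "e \<in> F" and bridge: "\<nexists>xs. simple_walk (F - {e}) xs \<and> e = {last xs, hd xs}"
    and \<phi>: "\<phi> \<in> faces F" "incident \<phi> e" and \<psi>: "\<psi> \<in> faces F" "incident \<psi> e"
  shows "\<phi> = \<psi>"
proof -
  let ?e = "path_image (\<gamma> e)"
  have eE: "e \<in> E" using F by auto
  obtain u v where e: "e = {u, v}" using card_edge[OF eE] by (auto simp: card_2_iff)
  define R where "R = {w. \<exists>xs. simple_walk (F - {e}) xs \<and> hd xs = u \<and> last xs = w}"
  have u: "u \<in> R" by (auto simp: R_def simple_walk_def intro!: exI[of _ "[u]"])
  have v: "v \<notin> R" using bridge unfolding e R_def by (auto simp: insert_commute)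
  define F1 where "F1 = {f \<in> F - {e}. f \<inter> R \<noteq> {}}"
  define F2 where "F2 = {f \<in> F - {e}. f \<inter> R = {}}"
  have F12: "F1 \<subseteq> E" "F2 \<subseteq> E" "e \<notin> F1" "e \<notin> F2" "F1 \<union> F2 = F - {e}"
    using F by (auto simp: F1_def F2_def)
  have F1R: "f \<subseteq> R" if f: "f \<in> F1" for f
  proof -
    obtain w where w: "w \<in> f" "w \<in> R" using f by (auto simp: F1_def)
    obtain w' where f': "f = {w, w'}"
      using card_2_other_end[OF card_edge w(1)] f F12 by blast
    obtain xs where xs: "simple_walk (F - {e}) xs" "hd xs = u" "last xs = w"
      using w(2) by (auto simp: R_def)
    then have "{last xs, w'} \<in> F - {e}" using f f' by (auto simp: F1_def)
    then obtain zs where "simple_walk (F - {e}) zs" "hd zs = hd xs" "last zs = w'"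
      by (rule simple_walk_extend[OF xs(1)])
    then have "w' \<in> R" using xs(2) unfolding R_def by blast
    then show ?thesis using w f' by auto
  qed
  have sing: "connected X" if "X \<subseteq> {z}" for X :: "complex set" and z
    using that by (metis connected_empty connected_sing subset_singletonD)
  have "?e \<inter> drawn F1 \<subseteq> {p u}"
    using edge_Int_drawn[OF eE F12(1,3)] F1R v e by auto
  then have c1: "connected (?e \<inter> drawn F1)" by (rule sing)
  have "drawn F1 \<inter> drawn F2 = {}"
  proof -
    have "path_image (\<gamma> f) \<inter> path_image (\<gamma> f') = {}" if "f \<in> F1" "f' \<in> F2" for f f'
    proof -
      have "f \<inter> f' = {}" "f \<noteq> f'" using that F1R by (auto simp: F1_def F2_def)
      then show ?thesis using edges_meet[of f f'] that F12 by auto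
    qed
    then show ?thesis by (auto simp: drawn_def)
  qed
  moreover have "?e \<inter> drawn F2 \<subseteq> {p v}"
    using edge_Int_drawn[OF eE F12(2,4)] u e by (auto simp: F2_def)
  ultimately have "(?e \<union> drawn F1) \<inter> drawn F2 \<subseteq> {p v}" by blast
  then have c2: "connected ((?e \<union> drawn F1) \<inter> drawn F2)" by (rule sing)
  have dF: "drawn F = ?e \<union> drawn F1 \<union> drawn F2"
    using drawn_remove[OF F(2)] drawn_Un[of F1 F2] F12(5) by auto
  obtain a b where ab: "a \<in> \<phi>" "b \<in> \<psi>"
    using face_nonempty[OF \<phi>(1)] face_nonempty[OF \<psi>(1)] by blast
  then have nd: "a \<notin> drawn F" "b \<notin> drawn F"
    using face_subset[OF \<phi>(1)] face_subset[OF \<psi>(1)] by blast+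
  have cc: "connected_component (- (drawn F1 \<union> drawn F2)) a b"
    using incident_faces_connected[OF F \<phi> ab(1) \<psi> ab(2)] F12(5) drawn_Un[of F1 F2] by simp
  have cc1: "connected_component (- drawn F1) a b" and cc2: "connected_component (- drawn F2) a b"
    by (rule connected_component_of_subset[OF cc]; blast)+
  have "connected_component (- ?e) a b"
    using connected_Compl_edge[OF eE] nd dF unfolding connected_component_def by blast
  then have "connected_component (- (?e \<union> drawn F1)) a b"
    using Janiszewski[OF _ closed_drawn[OF F12(1)] c1 _ cc1] by (simp add: compact_arc_image arc_edge eE)
  then have "connected_component (- ((?e \<union> drawn F1) \<union> drawn F2)) a b"
    using Janiszewski[OF _ closed_drawn[OF F12(2)] c2 _ cc2]
    by (simp add: compact_arc_image arc_edge eE compact_Un compact_drawn F12)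
  then show ?thesis using faces_eqI[of \<phi> F \<psi> a b] \<phi> \<psi> ab dF by simp
qed

lemma incident_faces_le_2:
  assumes F: "F \<subseteq> E" "e \<in> F"
  shows "finite {\<phi> \<in> faces F. incident \<phi> e} \<and> card {\<phi> \<in> faces F. incident \<phi> e} \<le> 2"
proof (cases "\<exists>xs. simple_walk (F - {e}) xs \<and> e = {last xs, hd xs}")
  case True
  then show ?thesis using incident_faces_of_cycle_edge[OF F] by blast
next
  case False
  let ?S = "{\<phi> \<in> faces F. incident \<phi> e}"
  have "\<phi> = \<psi>" if "\<phi> \<in> ?S" "\<psi> \<in> ?S" for \<phi> \<psi>
    using incident_faces_of_bridge[OF F False] that by blast
  then show ?thesis using finite_card_le_1I[of ?S] by fastforce
qed

lemma finite_faces: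
  assumes F: "F \<subseteq> E"
  shows "finite (faces F)"
proof (cases "\<exists>\<phi>\<in>faces F. \<exists>\<psi>\<in>faces F. \<phi> \<noteq> \<psi>")
  case False
  then show ?thesis using finite_card_le_1I[of "faces F"] by blast
next
  case True
  have "faces F \<subseteq> (\<Union>e\<in>F. {\<phi> \<in> faces F. incident \<phi> e})"
  proof
    fix \<phi> assume \<phi>: "\<phi> \<in> faces F"
    then obtain \<psi> where "\<psi> \<in> faces F" "\<phi> \<noteq> \<psi>" using True by metis
    then have "{e \<in> F. incident \<phi> e} \<noteq> {}"
      using face_frontier_has_cycle[OF F \<phi>] by (auto simp: acyclic_edges_def cycle_in_def)
    then show "\<phi> \<in> (\<Union>e\<in>F. {\<phi> \<in> faces F. incident \<phi> e})" using \<phi> by blast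
  qed
  moreover have "finite (\<Union>e\<in>F. {\<phi> \<in> faces F. incident \<phi> e})"
    using incident_faces_le_2[OF F] finite_sub[OF F] by blast
  ultimately show ?thesis by (rule finite_subset)
qed

lemma faces_ne:
  assumes "F \<subseteq> E"
  shows "faces F \<noteq> {}"
proof -
  have "drawn F \<noteq> UNIV"
    using compact_imp_bounded[OF compact_drawn[OF assms]] not_bounded_UNIV[where 'a=complex] by auto
  then show ?thesis unfolding faces_def components_eq_empty by blast
qed

text \<open>
  Insertion of an edge that closes a cycle keeps all faces except the one, \<open>U\<close>, through which the
  edge is drawn. The face \<open>U\<close> is divided into at least two faces, because an interior point of the
  edge is a frontier point of both sides of the Jordan curve drawn by the cycle.
\<close>

lemma card_faces_cycle_edge:
  assumes F: "F \<subseteq> E" "e \<in> F"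
    and xs: "simple_walk (F - {e}) xs" "e = {last xs, hd xs}"
  shows "card (faces (F - {e})) + 1 \<le> card (faces F)"
proof -
  let ?T = "drawn (F - {e})" and ?e = "path_image (\<gamma> e)"
  let ?o = "?e - p ` e"
  have eE: "e \<in> E" and FE: "F - {e} \<subseteq> E" using F by auto
  obtain A inn out where J: "connected A" "A \<subseteq> ?T" "compact (?e \<union> A)" "p ` e \<subseteq> A"
    "open inn" "open out" "connected inn" "connected out" "inn \<inter> out = {}"
    "inn \<union> out = - (?e \<union> A)" "?e \<subseteq> frontier inn" "?e \<subseteq> frontier out"
    by (rule closed_walk_Jordan[OF FE eE _ xs]) simp
  have dF: "drawn F = ?e \<union> ?T" by (rule drawn_remove[OF F(2)])
  have oT: "?o \<subseteq> - ?T" using open_edge_Int_drawn[OF eE FE] by auto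
  obtain x where x: "x \<in> ?o" using open_edge_ne[OF eE] by blast
  obtain U where U: "U \<in> faces (F - {e})" "?o \<subseteq> U"
    using exists_component_superset[OF oT _ connected_open_edge[OF eE]] oT x
    unfolding faces_def by blast
  have opU: "open U"
    using U(1) closed_drawn[OF FE] unfolding faces_def by (meson open_Compl open_components)
  have UT: "U \<subseteq> - ?T" using U(1) unfolding faces_def by (rule in_components_subset)
  have meet: "\<exists>a. a \<in> U \<and> a \<in> X" if "?e \<subseteq> frontier X" for X
  proof -
    have "x \<in> U \<inter> closure X" using that x U by (auto simp: frontier_def)
    then show ?thesis using open_Int_closure_eq_empty[OF opU, of X] by blast
  qed
  obtain a b where ab: "a \<in> U" "a \<in> inn" "b \<in> U" "b \<in> out" using meet J(11,12) by metis
  have abF: "a \<in> - drawn F" "b \<in> - drawn F" using ab UT J(10) dF by blast+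
  obtain \<phi> \<psi> where f: "\<phi> \<in> faces F" "a \<in> \<phi>" "\<psi> \<in> faces F" "b \<in> \<psi>"
    using abF Union_components[of "- drawn F"] unfolding faces_def by blast
  have sub: "\<phi> \<subseteq> - drawn F" "\<psi> \<subseteq> - drawn F" "connected \<phi>" "connected \<psi>"
    using f unfolding faces_def by (simp_all add: in_components_subset in_components_connected)
  have "\<phi> \<noteq> \<psi>"
  proof
    assume "\<phi> = \<psi>"
    then have "inn \<inter> \<phi> \<noteq> {}" "out \<inter> \<phi> \<noteq> {}" using f ab by auto
    moreover have "\<phi> \<subseteq> inn \<union> out" using sub(1) J(2,10) dF by blast
    ultimately show False
      using connectedD[OF sub(3) J(5,6)] J(9) by auto
  qed
  have inU: "\<phi> \<subseteq> U" "\<psi> \<subseteq> U"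
    using components_maximal[of U "- ?T"] U(1) sub dF f ab unfolding faces_def by blast+
  have other: "W \<in> faces F" if W: "W \<in> faces (F - {e})" "W \<noteq> U" for W
  proof -
    have "W \<inter> U = {}"
      using components_nonoverlap[of W "- ?T" U] W U by (simp add: faces_def)
    moreover have "W \<subseteq> - ?T" using W(1) unfolding faces_def by (rule in_components_subset)
    ultimately have "W \<subseteq> - drawn F" using dF U J(2,4) by blast
    then show ?thesis
      using components_intermediate_subset[of W "- ?T" "- drawn F"] W(1) dF
      unfolding faces_def by blast
  qed
  have new: "\<phi> \<notin> faces (F - {e}) - {U}" "\<psi> \<notin> faces (F - {e}) - {U}"
    using components_nonoverlap[of _ "- ?T" U] U(1) inU f unfolding faces_def by blast+
  have fin: "finite (faces (F - {e}))" by (rule finite_faces[OF FE])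
  have "card (faces (F - {e})) + 1 = card (insert \<phi> (insert \<psi> (faces (F - {e}) - {U})))"
    using new \<open>\<phi> \<noteq> \<psi>\<close> fin U(1) card_Suc_Diff1[OF fin U(1)] by simp
  also have "\<dots> \<le> card (faces F)"
    using f other by (intro card_mono finite_faces[OF F(1)]) auto
  finally show ?thesis .
qed

text \<open>
  Deleting edges that close a cycle decreases the number of faces with each edge, until a forest
  remains. A forest has at least one face and at most as many edges as vertices.
\<close>

lemma Euler_inequality: "F \<subseteq> E \<Longrightarrow> card F + 1 \<le> card (faces F) + card (\<Union>F)"
proof (induction "card F" arbitrary: F rule: less_induct)
  case less
  note F = less.prems
  show ?case
  proof (cases "acyclic_edges F")
    case True
    have "0 < card (faces F)" using finite_faces[OF F] faces_ne[OF F] by (simp add: card_gt_0_iff)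
    then show ?thesis
      using acyclic_edges_card_le[OF finite_sub[OF F] card_subset_edges[OF F] True] by linarith
  next
    case False
    then obtain xs where xs: "cycle_in F xs" by (auto simp: acyclic_edges_def)
    define e where "e = {last xs, hd xs}"
    have e: "e \<in> F" using xs by (auto simp: cycle_in_def e_def)
    have w: "simple_walk (F - {e}) xs"
      using xs closing_edge_notin_path_edges[of xs] by (auto simp: cycle_in_def simple_walk_def e_def)
    have c: "card F = Suc (card (F - {e}))" using card_Suc_Diff1[OF finite_sub[OF F] e] by simp
    have "card (F - {e}) + 1 \<le> card (faces (F - {e})) + card (\<Union>(F - {e}))"
      using less.hyps[of "F - {e}"] c F by auto
    moreover have "card (\<Union>(F - {e})) \<le> card (\<Union>F)"
      by (rule card_mono[OF finite_Union_sub[OF F]]) blast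
    ultimately show ?thesis using card_faces_cycle_edge[OF F e w e_def] c by linarith
  qed
qed

text \<open>
  With more than one face, count the incidences of faces and edges: with \<open>f\<close> faces, \<open>m\<close> edges and
  \<open>n\<close> vertices, \<open>g f \<le> 2 m\<close>, and \<open>f \<ge> m - n + 1\<close>. With only one face, the graph has no more edges
  than vertices.
\<close>

lemma edge_bound:
  assumes F: "F \<subseteq> E" "F \<noteq> {}" and g: "\<And>xs. cycle_in F xs \<Longrightarrow> g \<le> length xs" "0 < g"
  shows "g * card F < g * card (\<Union>F) + 2 * card F"
proof (cases "\<exists>\<phi>\<in>faces F. \<exists>\<psi>\<in>faces F. \<phi> \<noteq> \<psi>")
  case False
  then have "card (faces F) \<le> 1" using finite_card_le_1I[of "faces F"] by blast
  then have "card F \<le> card (\<Union>F)" using Euler_inequality[OF F(1)] by linarith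
  then have "g * card F \<le> g * card (\<Union>F)" by (rule mult_le_mono2)
  moreover have "0 < card F" using F finite_sub by (simp add: card_gt_0_iff)
  ultimately show ?thesis by linarith
next
  case True
  have "g \<le> card {e \<in> F. incident \<phi> e}" if \<phi>: "\<phi> \<in> faces F" for \<phi>
  proof -
    obtain \<psi> where "\<psi> \<in> faces F" "\<phi> \<noteq> \<psi>" using True \<phi> by metis
    then obtain xs where xs: "cycle_in {e \<in> F. incident \<phi> e} xs"
      using face_frontier_has_cycle[OF F(1) \<phi>] by (auto simp: acyclic_edges_def)
    then have "cycle_in F xs" by (auto simp: cycle_in_def simple_walk_def)
    then show ?thesis
      using g(1)[of xs] cycle_in_length_le_card[OF xs] finite_sub[OF F(1)] by simp
  qed
  then have "g * card (faces F) \<le> (\<Sum>\<phi>\<in>faces F. card {e \<in> F. incident \<phi> e})"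
    using sum_bounded_below[of "faces F" g "\<lambda>\<phi>. card {e \<in> F. incident \<phi> e}"] by (simp add: mult.commute)
  also have "\<dots> = (\<Sum>e\<in>F. card {\<phi> \<in> faces F. incident \<phi> e})"
    by (rule sum_multicount_gen) (auto simp: finite_faces finite_sub F)
  also have "\<dots> \<le> 2 * card F"
    using sum_bounded_above[of F "\<lambda>e. card {\<phi> \<in> faces F. incident \<phi> e}" 2]
      incident_faces_le_2[OF F(1)] by (simp add: mult.commute)
  finally have "g * card (faces F) \<le> 2 * card F" .
  moreover have "g * (card F + 1) \<le> g * (card (faces F) + card (\<Union>F))"
    using Euler_inequality[OF F(1)] by (rule mult_le_mono2)
  ultimately show ?thesis using g(2) by (simp add: algebra_simps)
qed

end


section \<open>An edge of small degree sum\<close>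

text \<open>
  Every vertex \<open>v\<close> sends the weight \<open>1 / d v\<close> to each of its edges, so that all edges together
  receive one unit per vertex. If every edge \<open>{u, v}\<close> had \<open>d u + d v \<ge> D + 2\<close>, then both degrees
  would lie between \<open>2\<close> and \<open>D\<close>, and by convexity an edge would receive at most
  \<open>1 / 2 + 1 / D\<close>, the value for degrees \<open>2\<close> and \<open>D\<close>. The resulting upper bound on the number of
  vertices contradicts the hypothesis on the number of edges.
\<close>

lemma light_edge:
  fixes F :: "'a set set" and D g :: nat
  defines "d \<equiv> \<lambda>v. card {f \<in> F. v \<in> f}"
  assumes fin: "finite F" and c2: "\<forall>e\<in>F. card e = 2" and ne: "F \<noteq> {}"
    and deg: "\<And>v. d v \<le> D" and D: "2 < D"
    and bound: "g * card F < g * card (\<Union>F) + 2 * card F" and g: "4 * D \<le> g * (D - 2)"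
  shows "\<exists>u v. {u, v} \<in> F \<and> u \<noteq> v \<and> d u + d v \<le> D + 1"
proof (rule ccontr)
  assume contra: "\<not> ?thesis"
  have heavy: "D + 2 \<le> d u + d v" if "{u, v} \<in> F" "u \<noteq> v" for u v
  proof -
    have "\<not> d u + d v \<le> D + 1" using contra that by blast
    then show ?thesis by linarith
  qed
  have finU: "finite (\<Union>F)" using fin c2 by (auto intro!: finite_Union intro: card_ge_0_finite)
  have d_pos: "0 < d v" if "v \<in> \<Union>F" for v
    using that fin unfolding d_def by (auto simp: card_gt_0_iff)
  have weight: "(\<Sum>v\<in>e. 1 / real (d v)) \<le> (real D + 2) / (2 * real D)" if e: "e \<in> F" for e
  proof -
    obtain u v where uv: "e = {u, v}" "u \<noteq> v" using c2 e by (auto simp: card_2_iff)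
    define x y where "x = real (d u)" and "y = real (d v)"
    have s: "real D + 2 \<le> x + y" using heavy[of u v] e uv unfolding x_def y_def by auto
    moreover have "x \<le> real D" "y \<le> real D" using deg unfolding x_def y_def by auto
    ultimately have xy: "2 \<le> x" "2 \<le> y" by linarith+
    \<comment> \<open>Convexity in the form \<open>(x - 2) (y - 2) \<ge> 0\<close>: for a given sum the product is least when one
      of the two numbers is \<open>2\<close>.\<close>
    have "2 * (x + y - 2) \<le> x * y"
      using mult_nonneg_nonneg[of "x - 2" "y - 2"] xy by (simp add: algebra_simps)
    then have "(real D + 2) * (2 * (x + y - 2)) \<le> (real D + 2) * (x * y)"
      by (intro mult_left_mono) auto
    moreover have "2 * real D * (x + y) \<le> (real D + 2) * (2 * (x + y - 2))"
      using s by (simp add: algebra_simps)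
    ultimately have "2 * real D * (x + y) \<le> (real D + 2) * (x * y)" by linarith
    then have "1 / x + 1 / y \<le> (real D + 2) / (2 * real D)"
      using xy D by (simp add: field_simps)
    then show ?thesis using uv by (simp add: x_def y_def)
  qed
  have one: "1 = (\<Sum>e\<in>{f \<in> F. v \<in> f}. 1 / real (d v))" if "v \<in> \<Union>F" for v
    using d_pos[OF that] by (simp add: d_def)
  have "real (card (\<Union>F)) = (\<Sum>v\<in>\<Union>F. 1)" by simp
  also have "\<dots> = (\<Sum>v\<in>\<Union>F. \<Sum>e\<in>{f \<in> F. v \<in> f}. 1 / real (d v))"
    by (rule sum.cong[OF refl one])
  also have "\<dots> = (\<Sum>e\<in>F. \<Sum>v\<in>{v \<in> \<Union>F. v \<in> e}. 1 / real (d v))"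
    by (rule sum.swap_restrict[OF finU fin])
  also have "\<dots> = (\<Sum>e\<in>F. \<Sum>v\<in>e. 1 / real (d v))"
    by (intro sum.cong refl) auto
  also have "\<dots> \<le> real (card F) * ((real D + 2) / (2 * real D))"
    using weight by (intro sum_bounded_above) auto
  finally have n: "2 * real D * real (card (\<Union>F)) \<le> real (card F) * (real D + 2)"
    using D by (simp add: field_simps)
  define m where "m = real (card F)"
  have m: "0 < m" using fin ne by (simp add: m_def card_gt_0_iff)
  have "real g * m < real g * real (card (\<Union>F)) + 2 * m"
    using bound unfolding m_def by (metis of_nat_add of_nat_less_iff of_nat_mult of_nat_numeral)
  then have "2 * real D * (real g * m) < 2 * real D * (real g * real (card (\<Union>F)) + 2 * m)"
    using D by (intro mult_strict_left_mono) auto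
  also have "\<dots> = real g * (2 * real D * real (card (\<Union>F))) + 4 * real D * m"
    by (simp add: algebra_simps)
  also have "\<dots> \<le> real g * (m * (real D + 2)) + 4 * real D * m"
    using n unfolding m_def by (intro add_right_mono mult_left_mono) auto
  finally have "m * (real g * (real D - 2)) < m * (4 * real D)" by (simp add: algebra_simps)
  then have "real g * (real D - 2) < 4 * real D" using m by simp
  moreover have "4 * real D \<le> real g * (real D - 2)"
    using g D by (metis of_nat_le_iff of_nat_mult of_nat_numeral of_nat_diff less_imp_le)
  ultimately show False by linarith
qed

section \<open>Group colorings\<close>

text \<open>
  Once the neighbours of a vertex have their colors, each of them forbids exactly one color at this
  vertex, whatever the orientation of the edge and the value of \<open>f\<close> on it. Hence a vertex with fewer
  than \<open>k\<close> neighbours may be colored last.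
\<close>

lemma greedy_coloring:
  assumes A: "comm_group A" and H: "simple_graph H" and Dr: "orientation H Dr"
    and L: "list_assignment A H k L" and f: "f \<in> edges H \<rightarrow> carrier A"
    and degen: "\<And>S. S \<subseteq> verts H \<Longrightarrow> S \<noteq> {} \<Longrightarrow> \<exists>v\<in>S. card {w \<in> S. {v, w} \<in> edges H} < k"
  shows "\<exists>c. group_coloring A H Dr f c \<and> (\<forall>v\<in>verts H. c v \<in> L v)"
proof -
  interpret comm_group A by (fact A)
  have fin: "finite (verts H)" using H by (simp add: simple_graph_def)
  have Lc: "L v \<subseteq> carrier A" "finite (L v)" "card (L v) = k" if "v \<in> verts H" for v
    using L that by (auto simp: list_assignment_def)
  have DrE: "{u, v} \<in> edges H" "u \<noteq> v" "(v, u) \<notin> Dr" if uv: "(u, v) \<in> Dr" for u v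
  proof -
    show e: "{u, v} \<in> edges H" using uv Dr by (auto simp: orientation_def)
    then have "card {u, v} = 2" using H unfolding simple_graph_def by blast
    then show "u \<noteq> v" by auto
    show "(v, u) \<notin> Dr" using uv Dr e by (auto simp: orientation_def)
  qed
  have "\<exists>c. (\<forall>v\<in>S. c v \<in> L v) \<and>
      (\<forall>(u, v)\<in>Dr. u \<in> S \<longrightarrow> v \<in> S \<longrightarrow> c u \<otimes>\<^bsub>A\<^esub> inv\<^bsub>A\<^esub> (c v) \<noteq> f {u, v})"
    if "S \<subseteq> verts H" for S
    using that
  proof (induction "card S" arbitrary: S)
    case 0
    then have "S = {}" using fin finite_subset by fastforce
    then show ?case by simp
  next
    case (Suc n)
    have finS: "finite S" using Suc.prems fin finite_subset by blast
    have "S \<noteq> {}" using Suc.hyps(2) by auto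
    then obtain v where v: "v \<in> S" and lt: "card {w \<in> S. {v, w} \<in> edges H} < k"
      using degen[OF Suc.prems] by blast
    obtain c where c: "\<forall>w\<in>S - {v}. c w \<in> L w"
      "\<forall>(u, w)\<in>Dr. u \<in> S - {v} \<longrightarrow> w \<in> S - {v} \<longrightarrow> c u \<otimes>\<^bsub>A\<^esub> inv\<^bsub>A\<^esub> (c w) \<noteq> f {u, w}"
    proof -
      have "n = card (S - {v})" "S - {v} \<subseteq> verts H" using Suc.hyps(2) Suc.prems v finS by auto
      from Suc.hyps(1)[OF this] that show thesis by blast
    qed
    define N where "N = {w \<in> S. {v, w} \<in> edges H}"
    \<comment> \<open>The one color that the neighbour \<open>w\<close> forbids at \<open>v\<close>: the solution \<open>x\<close> of
      \<open>x - c w = f {v, w}\<close> or of \<open>c w - x = f {v, w}\<close>, according to the orientation.\<close>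
    define forb where "forb w = (if (v, w) \<in> Dr then f {v, w} \<otimes>\<^bsub>A\<^esub> c w
      else inv\<^bsub>A\<^esub> (f {v, w}) \<otimes>\<^bsub>A\<^esub> c w)" for w
    have vH: "v \<in> verts H" using v Suc.prems by blast
    have "card (forb ` N) < card (L v)"
      using card_image_le[of N forb] lt finS Lc(3)[OF vH] by (simp add: N_def)
    moreover have "finite (forb ` N)" using finS by (simp add: N_def)
    ultimately obtain x where x: "x \<in> L v" "x \<notin> forb ` N"
      by (metis card_mono linorder_not_less subsetI)
    have xA: "x \<in> carrier A" using x(1) Lc(1)[OF vH] by blast
    have cA: "c w \<in> carrier A" if "w \<in> S" "w \<noteq> v" for w
      using c(1) that Lc(1)[of w] Suc.prems by blast
    let ?c = "c(v := x)"
    have "?c a \<otimes>\<^bsub>A\<^esub> inv\<^bsub>A\<^esub> (?c b) \<noteq> f {a, b}" if ab: "(a, b) \<in> Dr" "a \<in> S" "b \<in> S" for a b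
    proof -
      note E = DrE[OF ab(1)]
      have fA: "f {a, b} \<in> carrier A" using f E(1) by blast
      consider "a = v" | "b = v" | "a \<noteq> v" "b \<noteq> v" by blast
      then show ?thesis
      proof cases
        case 1
        then have "b \<in> N" using E(1) ab by (simp add: N_def)
        then have "x \<noteq> f {a, b} \<otimes>\<^bsub>A\<^esub> c b" using x(2) 1 ab(1) by (auto simp: forb_def)
        moreover have "x = f {a, b} \<otimes>\<^bsub>A\<^esub> c b" if "x \<otimes>\<^bsub>A\<^esub> inv\<^bsub>A\<^esub> (c b) = f {a, b}"
          using that inv_solve_right[of "f {a, b}" x "c b"] fA xA cA[of b] ab(3) E(2) 1 by auto
        ultimately show ?thesis using 1 E(2) by auto
      next
        case 2
        then have "a \<in> N" using E(1) ab by (simp add: N_def insert_commute)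
        then have "x \<noteq> inv\<^bsub>A\<^esub> (f {a, b}) \<otimes>\<^bsub>A\<^esub> c a"
          using x(2) 2 E(3) by (auto simp: forb_def insert_commute)
        moreover have "x = inv\<^bsub>A\<^esub> (f {a, b}) \<otimes>\<^bsub>A\<^esub> c a" if "c a \<otimes>\<^bsub>A\<^esub> inv\<^bsub>A\<^esub> x = f {a, b}"
          using that inv_solve_right[of "f {a, b}" "c a" x]
            inv_solve_left[of x "f {a, b}" "c a"] fA xA cA[of a] ab(2) E(2) 2 by auto
        ultimately show ?thesis using 2 E(2) by auto
      next
        case 3
        then show ?thesis using c(2) ab by auto
      qed
    qed
    moreover have "\<forall>w\<in>S. ?c w \<in> L w" using c(1) x(1) by auto
    ultimately show ?case by (intro exI[of _ ?c]) blast
  qed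
  from this[OF order_refl] obtain c where c: "\<forall>v\<in>verts H. c v \<in> L v"
    "\<forall>(u, v)\<in>Dr. u \<in> verts H \<longrightarrow> v \<in> verts H \<longrightarrow> c u \<otimes>\<^bsub>A\<^esub> inv\<^bsub>A\<^esub> (c v) \<noteq> f {u, v}"
    by blast
  have "u \<in> verts H \<and> v \<in> verts H" if "(u, v) \<in> Dr" for u v
    using DrE(1)[OF that] H unfolding simple_graph_def by blast
  then have "group_coloring A H Dr f c"
    using c Lc(1) unfolding group_coloring_def by blast
  then show ?thesis using c(1) by blast
qed

text \<open>
  The cyclic group of order \<open>m\<close>, transported to \<open>m\<close> elements of the given type.
\<close>

lemma comm_group_of_order:
  assumes "0 < m"
  obtains A :: "'g::infinite monoid" where "comm_group A" "finite (carrier A)" "card (carrier A) = m"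
proof -
  obtain B :: "'g set" where B: "finite B" "card B = m"
    using infinite_arbitrarily_large[OF infinite_UNIV] by blast
  obtain h where h: "bij_betw h {0..<m} B" using ex_bij_betw_nat_finite[OF B(1)] B(2) by blast
  define r where "r = the_inv_into {0..<m} h"
  have rh: "r (h i) = i" if "i < m" for i
    using the_inv_into_f_f[OF bij_betw_imp_inj_on[OF h]] that by (simp add: r_def)
  have hr: "h (r x) = x" and r: "r x < m" if "x \<in> B" for x
    using that h rh by (auto simp: bij_betw_def)
  have hB: "h i \<in> B" if "i < m" for i using h that by (auto simp: bij_betw_def)
  define A where "A = \<lparr>carrier = B, mult = (\<lambda>x y. h ((r x + r y) mod m)), one = h 0\<rparr>"
  have "comm_group A"
  proof (rule comm_groupI)
    fix x assume x: "x \<in> carrier A"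
    then have "h ((m - r x) mod m) \<otimes>\<^bsub>A\<^esub> x = \<one>\<^bsub>A\<^esub>"
      using assms r[of x] by (simp add: A_def rh mod_add_left_eq)
    then show "\<exists>y\<in>carrier A. y \<otimes>\<^bsub>A\<^esub> x = \<one>\<^bsub>A\<^esub>"
      using assms by (intro bexI[of _ "h ((m - r x) mod m)"]) (auto simp: A_def hB)
  qed (use assms in \<open>auto simp: A_def hB rh hr r mod_simps ac_simps\<close>)
  then show thesis using that[of A] B by (simp add: A_def)
qed

lemma simple_graph_finite_edges: "simple_graph G \<Longrightarrow> finite (edges G)"
  unfolding simple_graph_def by (meson Pow_iff finite_Pow_iff finite_subset subsetI)

lemma simple_graph_line_graph:
  assumes "simple_graph G"
  shows "simple_graph (line_graph G)"
  using simple_graph_finite_edges[OF assms] card_2_iff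
  unfolding simple_graph_def line_graph_def by fastforce

text \<open>
  For \<open>f = 0\<close> a group coloring is a proper coloring, and the edges at a vertex form a clique of the
  line graph.
\<close>

lemma degree_le_colors:
  assumes A: "comm_group A" "finite (carrier A)" and Dr: "orientation (line_graph G) Dr"
    and c: "group_coloring A (line_graph G) Dr (\<lambda>_. \<one>\<^bsub>A\<^esub>) c"
  shows "vertex_degree G v \<le> card (carrier A)"
proof -
  interpret comm_group A by (fact A(1))
  have cA: "c e \<in> carrier A" if "e \<in> edges G" for e
    using c that by (auto simp: group_coloring_def line_graph_def)
  have "inj_on c {e \<in> edges G. v \<in> e}"
  proof (rule inj_onI, rule ccontr)
    fix e e' assume e: "e \<in> {e \<in> edges G. v \<in> e}" "e' \<in> {e \<in> edges G. v \<in> e}"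
      and eq: "c e = c e'" and neq: "e \<noteq> e'"
    then have "{e, e'} \<in> edges (line_graph G)" by (auto simp: line_graph_def)
    then have "(e, e') \<in> Dr \<or> (e', e) \<in> Dr" using Dr unfolding orientation_def by blast
    then have "c e \<otimes>\<^bsub>A\<^esub> inv\<^bsub>A\<^esub> (c e') \<noteq> \<one>\<^bsub>A\<^esub> \<or> c e' \<otimes>\<^bsub>A\<^esub> inv\<^bsub>A\<^esub> (c e) \<noteq> \<one>\<^bsub>A\<^esub>"
      using c unfolding group_coloring_def by blast
    then show False using eq cA e by auto
  qed
  then show ?thesis
    unfolding vertex_degree_def using cA A(2) by (intro card_inj_on_le[of c]) auto
qed

lemma not_group_colorable_below_degree:
  assumes "simple_graph G" "comm_group A" "finite (carrier A)" "card (carrier A) < vertex_degree G v"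
  shows "\<not> group_colorable A (line_graph G)"
proof
  assume *: "group_colorable A (line_graph G)"
  interpret comm_group A by (fact assms(2))
  obtain Dr where Dr: "orientation (line_graph G) Dr"
    using orientation_exists[OF simple_graph_line_graph[OF assms(1)]] by blast
  have "(\<lambda>_. \<one>\<^bsub>A\<^esub>) \<in> edges (line_graph G) \<rightarrow> carrier A" by simp
  then obtain c where "group_coloring A (line_graph G) Dr (\<lambda>_. \<one>\<^bsub>A\<^esub>) c"
    using * Dr unfolding group_colorable_def group_colorable_wrt_def by blast
  then show False using degree_le_colors[OF assms(2,3) Dr, of c v] assms(4) by simp
qed

text \<open>
  A coloring without lists is a coloring from the constant lists given by \<open>k\<close> fixed group elements.
\<close>

lemma group_choosable_imp_colorable:
  assumes ch: "group_choosable TYPE('g::infinite) k H"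
    and A: "comm_group (A :: 'g monoid)" "order_at_least A k"
  shows "group_colorable A H"
proof -
  obtain B where B: "B \<subseteq> carrier A" "finite B" "card B = k"
  proof (cases "finite (carrier A)")
    case True
    then show thesis using A(2) that obtain_subset_with_card_n[of k "carrier A"]
      by (auto simp: order_at_least_def intro: finite_subset)
  next
    case False
    then show thesis using that infinite_arbitrarily_large[of "carrier A" k] by blast
  qed
  then have "list_assignment A H k (\<lambda>_. B)" by (simp add: list_assignment_def)
  then have "group_list_colorable A H (\<lambda>_. B)" using ch A by (auto simp: group_choosable_def)
  then show ?thesis
    unfolding group_list_colorable_def group_list_colorable_wrt_def
      group_colorable_def group_colorable_wrt_def by blast
qed

text \<open>
  The degree of a vertex bounds both numbers from below, so an upper bound on the choice number that
  equals some degree determines both of them.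
\<close>

lemma edge_numbers_eq:
  assumes G: "simple_graph G" and v: "vertex_degree G v = k" "0 < k"
    and ch: "group_choosable TYPE('g::infinite) k (line_graph G)"
  shows "group_edge_chromatic_number TYPE('g) G = k" "group_edge_choice_number TYPE('g) G = k"
proof -
  show "group_edge_chromatic_number TYPE('g) G = k"
    unfolding group_edge_chromatic_number_def group_chromatic_number_def
  proof (rule Least_equality)
    show "0 < k \<and> (\<forall>A::'g monoid. comm_group A \<and> order_at_least A k \<longrightarrow> group_colorable A (line_graph G))"
      using v(2) group_choosable_imp_colorable[OF ch] by blast
  next
    fix m assume m: "0 < m \<and> (\<forall>A::'g monoid. comm_group A \<and> order_at_least A m \<longrightarrow> group_colorable A (line_graph G))"
    obtain A :: "'g monoid" where A: "comm_group A" "finite (carrier A)" "card (carrier A) = m"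
      using comm_group_of_order m by blast
    moreover have "order_at_least A m" using A(3) by (simp add: order_at_least_def)
    ultimately have "group_colorable A (line_graph G)" using m by blast
    then show "k \<le> m"
      using not_group_colorable_below_degree[OF G A(1,2), of v] v(1) A(3) by linarith
  qed
  show "group_edge_choice_number TYPE('g) G = k"
    unfolding group_edge_choice_number_def group_choice_number_def
  proof (rule Least_equality)
    show "group_choosable TYPE('g) k (line_graph G)" by (fact ch)
  next
    fix m assume m: "group_choosable TYPE('g) m (line_graph G)"
    show "k \<le> m"
    proof (cases "m = 0")
      case False
      then obtain A :: "'g monoid" where A: "comm_group A" "finite (carrier A)" "card (carrier A) = m"
        using comm_group_of_order by blast
      moreover have "order_at_least A m" using A(3) by (simp add: order_at_least_def)
      ultimately have "group_colorable A (line_graph G)"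
        using group_choosable_imp_colorable[OF m] by blast
      then show ?thesis
        using not_group_colorable_below_degree[OF G A(1,2), of v] v(1) A(3) by linarith
    next
      case True
      \<comment> \<open>There is no group of order \<open>0\<close>, so \<open>m = 0\<close> is excluded by empty lists instead.\<close>
      obtain A :: "'g monoid" where A: "comm_group A"
        using comm_group_of_order[of 1] by auto
      interpret comm_group A by (fact A)
      obtain e where e: "e \<in> edges G"
        using v by (auto simp: vertex_degree_def card_gt_0_iff)
      obtain Dr where Dr: "orientation (line_graph G) Dr"
        using orientation_exists[OF simple_graph_line_graph[OF G]] by blast
      have "list_assignment A (line_graph G) m (\<lambda>_. {})" "order_at_least A m"
        using True by (simp_all add: list_assignment_def order_at_least_def)
      then have "group_list_colorable_wrt A (line_graph G) Dr (\<lambda>_. {})"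
        using m A Dr by (auto simp: group_choosable_def group_list_colorable_def)
      moreover have "(\<lambda>_. \<one>\<^bsub>A\<^esub>) \<in> edges (line_graph G) \<rightarrow> carrier A" by simp
      ultimately have "\<exists>c. \<forall>e\<in>verts (line_graph G). c e \<in> ({} :: 'g set)"
        unfolding group_list_colorable_wrt_def by blast
      then show ?thesis using e by (auto simp: line_graph_def)
    qed
  qed
qed

lemma line_graph_neighbours:
  assumes S: "finite S" "{u, v} \<in> S" "u \<noteq> v"
  shows "card {w \<in> S. {{u, v}, w} \<in> edges (line_graph G)} + 2
    \<le> card {f \<in> S. u \<in> f} + card {f \<in> S. v \<in> f}"
proof -
  let ?e = "{u, v}"
  have "{w \<in> S. {?e, w} \<in> edges (line_graph G)} \<subseteq> ({f \<in> S. u \<in> f} - {?e}) \<union> ({f \<in> S. v \<in> f} - {?e})"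
    by (auto simp: line_graph_def doubleton_eq_iff)
  then have "card {w \<in> S. {?e, w} \<in> edges (line_graph G)}
      \<le> card (({f \<in> S. u \<in> f} - {?e}) \<union> ({f \<in> S. v \<in> f} - {?e}))"
    using S(1) by (intro card_mono) auto
  also have "\<dots> \<le> card ({f \<in> S. u \<in> f} - {?e}) + card ({f \<in> S. v \<in> f} - {?e})"
    by (rule card_Un_le)
  finally show ?thesis
    using card_Suc_Diff1[of "{f \<in> S. u \<in> f}" ?e] card_Suc_Diff1[of "{f \<in> S. v \<in> f}" ?e] S
    by simp
qed

section \<open>Planar graphs of large girth\<close>

lemma planar_edge_bound:
  assumes G: "simple_graph G" "planar G" and g: "enat g \<le> girth G" "0 < g"
    and S: "S \<subseteq> edges G" "S \<noteq> {}"
  shows "g * card S < g * card (\<Union>S) + 2 * card S"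
proof -
  obtain p \<gamma> where d: "plane_drawing G p \<gamma>" using G(2) by (auto simp: planar_def)
  interpret drawing "edges G" p \<gamma>
    using d G(1) simple_graph_finite_edges[OF G(1)]
    by unfold_locales (auto simp: plane_drawing_def simple_graph_def inj_on_subset)
  have "g \<le> length xs" if "cycle_in S xs" for xs
  proof -
    have "cycle_in (edges G) xs" using that S(1) by (auto simp: cycle_in_def simple_walk_def)
    then have "enat g \<le> enat (length xs)" using girth_le_cycle_in g(1) order_trans by blast
    then show ?thesis by simp
  qed
  then show ?thesis using edge_bound S g(2) by blast
qed

lemma line_graph_group_choosable:
  assumes G: "simple_graph G" "planar G" and g: "enat g \<le> girth G" "4 * D \<le> g * (D - 2)"
    and D: "2 < D" "\<And>v. vertex_degree G v \<le> D"
  shows "group_choosable TYPE('g::infinite) D (line_graph G)"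
proof -
  have fin: "finite (edges G)" by (rule simple_graph_finite_edges[OF G(1)])
  have degen: "\<exists>e\<in>S. card {e' \<in> S. {e, e'} \<in> edges (line_graph G)} < D"
    if S: "S \<subseteq> verts (line_graph G)" "S \<noteq> {}" for S
  proof -
    have SE: "S \<subseteq> edges G" using S by (simp add: line_graph_def)
    have finS: "finite S" using SE fin by (rule finite_subset)
    have "0 < g" using g(2) D(1) by (cases g) auto
    then have bound: "g * card S < g * card (\<Union>S) + 2 * card S"
      using planar_edge_bound[OF G g(1) _ SE S(2)] by blast
    have "card {f \<in> S. v \<in> f} \<le> D" for v
    proof -
      have "card {f \<in> S. v \<in> f} \<le> vertex_degree G v"
        unfolding vertex_degree_def using SE fin by (intro card_mono) auto
      then show ?thesis using D(2)[of v] by (rule order_trans)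
    qed
    moreover have "\<forall>e\<in>S. card e = 2" using G(1) SE by (auto simp: simple_graph_def)
    ultimately obtain u v where uv: "{u, v} \<in> S" "u \<noteq> v"
      "card {f \<in> S. u \<in> f} + card {f \<in> S. v \<in> f} \<le> D + 1"
      using light_edge[OF finS _ S(2) _ D(1) bound g(2)] by blast
    then have "card {e' \<in> S. {{u, v}, e'} \<in> edges (line_graph G)} < D"
      using line_graph_neighbours[OF finS uv(1,2), of G] by linarith
    then show ?thesis using uv(1) by blast
  qed
  show ?thesis
    unfolding group_choosable_def group_list_colorable_def group_list_colorable_wrt_def
    using greedy_coloring[OF _ simple_graph_line_graph[OF G(1)] _ _ _ degen] by blast
qed

theorem theorem2p7:
  fixes G :: "'a ugraph" and \<Delta> :: nat
  assumes "3 \<le> \<Delta>"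
    and "simple_graph G"
    and "planar G"
    and "\<Delta> \<le> max_degree G"
    and "enat (4 + nat \<lceil>8 / (real \<Delta> - 2)\<rceil>) \<le> girth G"
  shows "group_edge_chromatic_number TYPE('g::infinite) G = max_degree G
    \<and> group_edge_choice_number TYPE('g) G = max_degree G"
proof -
  define g where "g = 4 + nat \<lceil>8 / (real \<Delta> - 2)\<rceil>"
  let ?D = "max_degree G"
  have finV: "finite (verts G)" using assms(2) by (simp add: simple_graph_def)
  have D: "2 < ?D" using assms(1,4) by simp
  have "?D \<in> insert 0 (vertex_degree G ` verts G)"
    unfolding max_degree_def using finV by (intro Max_in) auto
  then obtain v where v: "vertex_degree G v = ?D" using D by auto
  have deg: "vertex_degree G v \<le> ?D" for v
  proof (cases "v \<in> verts G")
    case True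
    then show ?thesis unfolding max_degree_def using finV by (intro Max_ge) auto
  next
    case False
    then have no: "{e \<in> edges G. v \<in> e} = {}" using assms(2) by (auto simp: simple_graph_def)
    show ?thesis unfolding vertex_degree_def no by simp
  qed
  \<comment> \<open>The bound on the girth decreases in \<open>\<Delta>\<close>, so it holds with the maximum degree for \<open>\<Delta>\<close> as
    well.\<close>
  have "4 + 8 / (real ?D - 2) \<le> 4 + 8 / (real \<Delta> - 2)"
    using assms(1,4) by (intro add_left_mono divide_left_mono) auto
  also have "\<dots> \<le> real g" unfolding g_def by (simp add: real_nat_ceiling_ge)
  finally have "4 * real ?D \<le> real g * (real ?D - 2)"
    using D by (simp add: field_simps)
  then have "real (4 * ?D) \<le> real (g * (?D - 2))"
    using D by (simp add: of_nat_diff)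
  then have g: "4 * ?D \<le> g * (?D - 2)" by (simp only: of_nat_le_iff)
  have "enat g \<le> girth G" using assms(5) by (simp only: g_def)
  then have "group_choosable TYPE('g) ?D (line_graph G)"
    by (rule line_graph_group_choosable[OF assms(2,3) _ g D deg])
  then show ?thesis
    using edge_numbers_eq[where 'g = 'g, OF assms(2) v] D by simp
qed

end
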